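(* Let $r,u,m,n,k\in\mathbb{N}$ and $i\in\{0,1\}$. Then (1) $D_k(r,u,m,n)=\left[\begin{array}{c}r\\k\end{array}\right]D_{r,u,m}(n)$; (2) $D(r,u,m,n)=r!\,D_{r,u,m}(n)$; (3) $D^{(i)}(r,u,m,n)=\frac{r!}{2}D_{r,u,m}(n)$ if $r\ge 2$, and $D^{(i)}(r,u,m,n)=D^{(i)}_{r,u,m}(n)$ if $r\in\{0,1\}$; (4) $D_k^{(i)}(r,u,m,n)=\left[\begin{array}{c}r\\k\end{array}\right]D^{((r+k+i)\bmod 2)}_{r,u,m}(n)$.
   Context: $\mathbb{N}$ denotes the non-negative integers and $\mathcal{S}_N$ the set of permutations of $\{1,\ldots,N\}$. For a permutation $\sigma$, $\mathrm{par}\,\sigma=0$ if $\sigma$ is even and $1$ if odd. Cycles are those of the disjoint cycle decomposition, fixed points counted as 1-cycles. $\mathcal{D}(r,u,m,n)$ is the set of $\sigma\in\mathcal{S}_{r+n}$ such that there are exactly $u$ elements $x\in\{1,\ldots,r\}$ with $\sigma(x)\in\{1,\ldots,r\}$, and exactly $m$ elements $t\in\{r+1,\ldots,r+n\}$ with $\sigma(t)=t$. $D(r,u,m,n)=\#\mathcal{D}(r,u,m,n)$. $D_k(r,u,m,n)$ is the number of $\sigma\in\mathcal{D}(r,u,m,n)$ having exactly $k$ cycles containing at least one element of $\{1,\ldots,r\}$; $D^{(i)}(r,u,m,n)$ is the number of $\sigma\in\mathcal{D}(r,u,m,n)$ with $\mathrm{par}\,\sigma=i$; $D^{(i)}_k(r,u,m,n)$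 is the number of $\sigma\in\mathcal{D}(r,u,m,n)$ with both properties. $\mathcal{D}_{r,u,m}(n)$ is the set of $\sigma\in\mathcal{S}_{r+n}$ such that any two distinct elements of $\{1,\ldots,r\}$ lie in different cycles of $\sigma$, exactly $u$ elements of $\{1,\ldots,r\}$ are fixed by $\sigma$, and exactly $m$ elements of $\{r+1,\ldots,r+n\}$ are fixed by $\sigma$. $D_{r,u,m}(n)=\#\mathcal{D}_{r,u,m}(n)$ and $D^{(i)}_{r,u,m}(n)$ is the number of its elements of parity $i$. $\left[\begin{array}{c}r\\k\end{array}\right]$ is the unsigned Stirling number of the first kind: the number of permutations of $\{1,\ldots,r\}$ with exactly $k$ cycles (equivalently, $\prod_{j=0}^{r-1}(x+j)=\sum_k \left[\begin{array}{c}r\\k\end{array}\right]x^k$). *)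

theory Defs
  imports Complex_Main "HOL-Combinatorics.Combinatorics" "HOL-Combinatorics.Orbits"
begin

definition par :: "(nat \<Rightarrow> nat) \<Rightarrow> nat" where
  "par \<sigma> = (if evenperm \<sigma> then 0 else 1)"

text \<open>
  A cycle of the disjoint cycle decomposition is represented by its underlying set of elements,
  that is, by an orbit. Since \<open>orbit f x\<close> consists of the \<open>(f ^^ n) x\<close> with \<open>n > 0\<close>, a fixed
  point \<open>x\<close> of \<open>\<sigma>\<close> contributes the singleton \<open>{x}\<close>.
\<close>
definition cycles :: "nat \<Rightarrow> (nat \<Rightarrow> nat) \<Rightarrow> nat set set" where
  "cycles N \<sigma> = orbit \<sigma> ` {1..N}"

definition DD :: "nat \<Rightarrow> nat \<Rightarrow> nat \<Rightarrow> nat \<Rightarrow> (nat \<Rightarrow> nat) set" where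
  "DD r u m n = {\<sigma>. \<sigma> permutes {1..r+n}
     \<and> card {x \<in> {1..r}. \<sigma> x \<in> {1..r}} = u
     \<and> card {t \<in> {r+1..r+n}. \<sigma> t = t} = m}"

text \<open>
  In the names below the suffix \<open>_k\<close> stands for the subscript \<open>k\<close> (the number of cycles meeting
  \<open>{1..r}\<close>) and \<open>_par\<close> for the parenthesised superscript \<open>(i)\<close>; these parameters come first.
\<close>
definition D :: "nat \<Rightarrow> nat \<Rightarrow> nat \<Rightarrow> nat \<Rightarrow> nat" where
  "D r u m n = card (DD r u m n)"

definition D_k :: "nat \<Rightarrow> nat \<Rightarrow> nat \<Rightarrow> nat \<Rightarrow> nat \<Rightarrow> nat" where
  "D_k k r u m n =
     card {\<sigma> \<in> DD r u m n. card {C \<in> cycles (r+n) \<sigma>. C \<inter> {1..r} \<noteq> {}} = k}"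

definition D_par :: "nat \<Rightarrow> nat \<Rightarrow> nat \<Rightarrow> nat \<Rightarrow> nat \<Rightarrow> nat" where
  "D_par i r u m n = card {\<sigma> \<in> DD r u m n. par \<sigma> = i}"

definition D_k_par :: "nat \<Rightarrow> nat \<Rightarrow> nat \<Rightarrow> nat \<Rightarrow> nat \<Rightarrow> nat \<Rightarrow> nat" where
  "D_k_par k i r u m n =
     card {\<sigma> \<in> DD r u m n.
             card {C \<in> cycles (r+n) \<sigma>. C \<inter> {1..r} \<noteq> {}} = k \<and> par \<sigma> = i}"

text \<open>
  The set and the numbers written with all of \<open>r, u, m\<close> as subscripts, where the elements of
  \<open>{1..r}\<close> lie in pairwise different cycles.
\<close>
definition DD_sub :: "nat \<Rightarrow> nat \<Rightarrow> nat \<Rightarrow> nat \<Rightarrow> (nat \<Rightarrow> nat) set" where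
  "DD_sub r u m n = {\<sigma>. \<sigma> permutes {1..r+n}
     \<and> (\<forall>x\<in>{1..r}. \<forall>y\<in>{1..r}. x \<noteq> y \<longrightarrow> orbit \<sigma> x \<noteq> orbit \<sigma> y)
     \<and> card {x \<in> {1..r}. \<sigma> x = x} = u
     \<and> card {t \<in> {r+1..r+n}. \<sigma> t = t} = m}"

definition D_sub :: "nat \<Rightarrow> nat \<Rightarrow> nat \<Rightarrow> nat \<Rightarrow> nat" where
  "D_sub r u m n = card (DD_sub r u m n)"

definition D_sub_par :: "nat \<Rightarrow> nat \<Rightarrow> nat \<Rightarrow> nat \<Rightarrow> nat \<Rightarrow> nat" where
  "D_sub_par i r u m n = card {\<sigma> \<in> DD_sub r u m n. par \<sigma> = i}"

end

theory Submission
  imports Defs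
begin

text \<open>
  Let \<open>R = {1..r}\<close> and let \<open>p\<close> be the first-return map of \<open>\<sigma>\<close> to \<open>R\<close>, a permutation of \<open>R\<close> whose cycles
  are the traces on \<open>R\<close> of the cycles of \<open>\<sigma>\<close> meeting \<open>R\<close>. Precomposing \<open>\<sigma>\<close> with a permutation of \<open>R\<close>
  precomposes the first-return map with it, so \<open>\<rho> = \<sigma> \<circ> inv p\<close> returns every point of \<open>R\<close> to itself,
  which means that the points of \<open>R\<close> lie in different cycles of \<open>\<rho>\<close>. Hence \<open>(\<rho>, p) \<mapsto> \<rho> \<circ> p\<close> is a
  bijection under which the cycles meeting \<open>R\<close> are counted by \<open>p\<close> alone, and the parity splits because
  a permutation of \<open>r\<close> points with \<open>k\<close> cycles has the parity of \<open>r + k\<close>.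
\<close>

section \<open>First-return maps and their cycles\<close>

inductive first_return :: "('a \<Rightarrow> 'a) \<Rightarrow> 'a set \<Rightarrow> 'a \<Rightarrow> 'a \<Rightarrow> bool" for f R where
  enter: "f x \<in> R \<Longrightarrow> first_return f R x (f x)"
| pass: "f x \<notin> R \<Longrightarrow> first_return f R (f x) y \<Longrightarrow> first_return f R x y"

lemma first_return_in: "first_return f R x y \<Longrightarrow> y \<in> R"
  by (induction rule: first_return.induct) auto

lemma first_return_in_orbit: "first_return f R x y \<Longrightarrow> y \<in> orbit f x"
  by (induction rule: first_return.induct) (auto intro: orbit.base orbit_subset)

lemma first_return_unique:
  assumes "first_return f R x y" "first_return f R x z"
  shows "y = z"
  using assms
proof (induction arbitrary: z rule: first_return.induct)
  case (enter x)
  then show ?case by (auto elim: first_return.cases)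
next
  case (pass x y)
  from pass.prems pass.hyps(1) have "first_return f R (f x) z"
    by (auto elim: first_return.cases)
  then show ?case by (rule pass.IH)
qed

lemma first_return_exists:
  assumes "y \<in> orbit f x" "y \<in> R"
  shows "\<exists>z. first_return f R x z"
proof -
  \<comment> \<open>Invariant along the orbit of \<open>x\<close>: either a return has already
    occurred, or the walk is still outside \<open>R\<close> and any later return of \<open>y\<close>
    is the return of \<open>x\<close>. At a point of \<open>R\<close> the second alternative is
    excluded.\<close>
  from assms(1) have "(\<exists>z. first_return f R x z) \<or>
    (y \<notin> R \<and> (\<forall>z. first_return f R y z \<longrightarrow> first_return f R x z))"
    by induction (metis first_return.intros)+
  with assms(2) show ?thesis by blast
qed

text \<open>Outside \<open>R\<close> the maps \<open>f \<circ> p\<close> and \<open>f\<close> agree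
  because \<open>p\<close> fixes those points, so \<open>p\<close> only changes the start of the
  path from \<open>x\<close> to \<open>p x\<close>.\<close>

lemma first_return_comp:
  assumes "p permutes R" "first_return f R (p x) y"
  shows "first_return (f \<circ> p) R x y"
proof -
  \<comment> \<open>The start \<open>p x\<close> is generalised to \<open>z\<close> for the
    induction; in the case \<open>pass\<close> the hypothesis is used at \<open>f z\<close>, its own
    image under \<open>p\<close>.\<close>
  have "\<forall>x. p x = z \<longrightarrow> first_return (f \<circ> p) R x y" if "first_return f R z y" for z
    using that
  proof (induction rule: first_return.induct)
    case (enter z)
    then show ?case by (metis comp_apply first_return.enter)
  next
    case (pass z y)
    then have "p (f z) = f z" using assms(1) by (simp add: permutes_not_in)
    with pass show ?case by (metis comp_apply first_return.pass)
  qed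
  with assms(2) show ?thesis by blast
qed

text \<open>Walk from \<open>x\<close> along \<open>f\<close> and let \<open>w\<close> be the last
  point of \<open>R\<close> met so far, initially \<open>x\<close>. All returns of the current point
  \<open>z\<close> are returns of \<open>w\<close>, so the next point of \<open>R\<close> met is
  \<open>g w\<close>, and the walk meets \<open>R\<close> only in the \<open>g\<close>-orbit of
  \<open>x\<close>.\<close>

lemma orbit_first_return:
  assumes "x \<in> R" and g: "\<And>y. y \<in> R \<Longrightarrow> first_return f R y (g y)"
    and "z \<in> orbit f x"
  shows "(z \<in> R \<longrightarrow> z \<in> orbit g x) \<and>
    (\<exists>w\<in>R. (w = x \<or> w \<in> orbit g x) \<and> (\<forall>v. first_return f R z v \<longrightarrow> first_return f R w v))"
    (is "?P z")
proof -
  have next_point: "?P (f z)"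
    if w: "w \<in> R" "w = x \<or> w \<in> orbit g x"
      and zw: "\<forall>v. first_return f R z v \<longrightarrow> first_return f R w v" for z w
  proof (cases "f z \<in> R")
    case True
    have "first_return f R w (f z)" using zw first_return.enter[of f z R, OF True] by simp
    then have "f z = g w" using g[OF w(1)] by (rule first_return_unique)
    then have "f z \<in> orbit g x" using w(2) by (auto intro: orbit.intros)
    with True show ?thesis by auto
  next
    case False
    then have "\<forall>v. first_return f R (f z) v \<longrightarrow> first_return f R w v"
      using zw first_return.pass[of f z R, OF False] by simp
    with w False show ?thesis by auto
  qed
  from assms(3) show ?thesis
  proof induction
    case base
    show ?case by (rule next_point[of x]) (simp_all add: assms(1))
  next
    case (step y)
    then obtain w where "w \<in> R" "w = x \<or> w \<in> orbit g x"
      "\<forall>v. first_return f R y v \<longrightarrow> first_return f R w v" by auto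
    then show ?case by (rule next_point)
  qed
qed

lemma orbit_Int_first_return:
  assumes "x \<in> R" and g: "\<And>y. y \<in> R \<Longrightarrow> first_return f R y (g y)"
  shows "orbit f x \<inter> R = orbit g x"
proof
  show "orbit f x \<inter> R \<subseteq> orbit g x"
    using orbit_first_return[of x R f g] assms by blast
  show "orbit g x \<subseteq> orbit f x \<inter> R"
  proof
    fix z assume "z \<in> orbit g x"
    then show "z \<in> orbit f x \<inter> R"
    proof induction
      case base
      show ?case using g[OF assms(1)] first_return_in first_return_in_orbit by fast
    next
      case (step y)
      then have "first_return f R y (g y)" using g by blast
      with step show ?case by (blast intro: orbit_trans dest: first_return_in first_return_in_orbit)
    qed
  qed
qed

lemma return_map_exists:
  assumes "f permutes A" "finite A" "R \<subseteq> A"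
  obtains p where "p permutes R" "\<And>x. x \<in> R \<Longrightarrow> first_return f R x (p x)"
proof -
  have perm: "permutation f" using assms permutation_permutes by blast
  \<comment> \<open>The value \<open>x\<close> off \<open>R\<close> is what makes \<open>p\<close> a
    permutation of \<open>R\<close> in the sense of \<open>permutes\<close>.\<close>
  define p where "p x = (if x \<in> R then THE y. first_return f R x y else x)" for x
  have p: "first_return f R x (p x)" if x: "x \<in> R" for x
  proof -
    obtain y where "first_return f R x y"
      using first_return_exists[OF permutation_self_in_orbit[OF perm] x] by blast
    then have "first_return f R x (THE y. first_return f R x y)"
      by (rule theI) (metis \<open>first_return f R x y\<close> first_return_unique)
    then show ?thesis using x by (simp add: p_def)
  qed
  \<comment> \<open>Surjectivity suffices, since \<open>R\<close> is finite. Going around the cycle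
    of \<open>y\<close> up to its predecessor \<open>z\<close>, the last point \<open>w\<close> of
    \<open>R\<close> met has \<open>y\<close> as its first return.\<close>
  have "R \<subseteq> p ` R"
  proof
    fix y assume y: "y \<in> R"
    obtain z where z: "z \<in> orbit f y" "y = f z"
      using permutation_self_in_orbit[OF perm, of y] by (metis orbit.cases)
    then obtain w where "w \<in> R" "first_return f R w y"
      using orbit_first_return[of y R f p, OF y p z(1)] y first_return.enter by metis
    then show "y \<in> p ` R" using p first_return_unique by (metis image_eqI)
  qed
  moreover have "p ` R \<subseteq> R" using p first_return_in by fast
  ultimately have img: "p ` R = R" by blast
  have "finite R" using assms finite_subset by blast
  then have "bij_betw p R R"
    using img by (simp add: bij_betw_def finite_surj_inj)
  then have "p permutes R" by (rule bij_imp_permutes) (simp add: p_def)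
  then show ?thesis using that p by blast
qed

text \<open>The trace on \<open>R\<close> determines a cycle meeting \<open>R\<close>: cycles with a
  common point coincide, and each \<open>x\<close> in \<open>R\<close> lies in its own
  orbit.\<close>

lemma card_orbits_first_return:
  assumes "permutation f" and g: "\<And>y. y \<in> R \<Longrightarrow> first_return f R y (g y)"
  shows "card (orbit f ` R) = card (orbit g ` R)"
proof -
  have "orbit g ` R = (\<lambda>C. C \<inter> R) ` orbit f ` R"
    using orbit_Int_first_return[of _ R f g] g by (auto simp: image_image)
  moreover have "inj_on (\<lambda>C. C \<inter> R) (orbit f ` R)"
  proof (rule inj_onI, clarsimp)
    fix x y assume xy: "x \<in> R" "y \<in> R" "orbit f x \<inter> R = orbit f y \<inter> R"
    then have "x \<in> orbit f y" using permutation_self_in_orbit[OF assms(1), of x] by blast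
    then show "orbit f x = orbit f y"
      using cyclic_on_orbit'[OF assms(1)] by (metis orbit_cyclic_eq3)
  qed
  ultimately show ?thesis by (simp add: card_image)
qed

section \<open>Numbers of cycles and signs of permutations of a finite set\<close>

text \<open>For \<open>b\<close> in \<open>S\<close>, composing with the transposition inserts
  \<open>a\<close> just before \<open>b\<close> in the cycle of \<open>b\<close>; then
  \<open>p\<close> is the first-return map to \<open>S\<close> and the number of cycles is
  unchanged. For \<open>a = b\<close> the point \<open>a\<close> becomes a new 1-cycle.\<close>

lemma orbits_insert_transpose:
  assumes "finite S" "a \<notin> S" "b \<in> insert a S" "p permutes S"
  shows "card (orbit (transpose a b \<circ> p) ` insert a S) = card (orbit p ` S) + (if a = b then 1 else 0)"
proof -
  let ?q = "transpose a b \<circ> p"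
  have pa: "p a = a" using assms by (simp add: permutes_not_in)
  show ?thesis
  proof (cases "a = b")
    case True
    have "orbit p a = {a}" using pa by (simp add: orbit_eq_singleton_iff)
    moreover have "{a} \<notin> orbit p ` S" using permutes_orbit_subset[OF assms(4)] assms(2) by fastforce
    ultimately show ?thesis using True assms(1) by simp
  next
    case False
    then have b: "b \<in> S" using assms by simp
    have q: "permutation ?q"
      using assms by (meson permutation_compose permutation_permutes permutation_swap_id)
    have "first_return ?q S x (p x)" if x: "x \<in> S" for x
    proof -
      have px: "p x \<in> S" "p x \<noteq> a" using assms x permutes_in_image[OF assms(4)] by metis+
      show ?thesis
      proof (cases "p x = b")
        case True
        then have "?q x = a" "?q a = b" using pa by simp_all
        then show ?thesis using True b assms(2) by (metis first_return.intros)
      next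
        case False
        then have "?q x = p x" using px by simp
        then show ?thesis using px by (metis first_return.enter)
      qed
    qed
    then have "card (orbit ?q ` S) = card (orbit p ` S)"
      by (rule card_orbits_first_return[OF q])
    moreover have "orbit ?q a = orbit ?q b"
      using permutation_orbit_step[OF q, of a] pa by simp
    then have "orbit ?q ` insert a S = orbit ?q ` S" using b by auto
    ultimately show ?thesis using False by simp
  qed
qed

lemma permutes_insert_image:
  "{p. p permutes insert a S} = (\<lambda>(b, p). transpose a b \<circ> p) ` (insert a S \<times> {p. p permutes S})"
  unfolding permutes_insert by (rule arg_cong[where f = "image _"]) auto

lemma inj_on_transpose_comp:
  assumes "a \<notin> S"
  shows "inj_on (\<lambda>(b, p). transpose a b \<circ> p) (insert a S \<times> {p. p permutes S})"
proof (rule inj_onI, clarsimp)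
  fix b p c q
  assume pq: "p permutes S" "q permutes S" and eq: "transpose a b \<circ> p = transpose a c \<circ> q"
  \<comment> \<open>The index \<open>b\<close> is recovered as the image of \<open>a\<close>; then
    the transposition cancels.\<close>
  have "p a = a" "q a = a" using pq assms by (simp_all add: permutes_not_in)
  then have "b = c" using fun_cong[OF eq, of a] by simp
  moreover from this have "p = q" using eq by (metis comp_assoc id_comp transpose_comp_involutory)
  ultimately show "b = c \<and> p = q" by simp
qed

text \<open>This is the Stirling recurrence: the new point \<open>a\<close> either forms a 1-cycle,
  leaving \<open>k - 1\<close> cycles on \<open>S\<close>, or is inserted before one of the
  \<open>card S\<close> old points, leaving \<open>k\<close>.\<close>

lemma card_permutes_orbits:
  assumes "finite S"
  shows "card {p. p permutes S \<and> card (orbit p ` S) = k} = stirling (card S) k"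
  using assms
proof (induction arbitrary: k rule: finite_induct)
  case empty
  have "{p. p = id \<and> k = 0} = (if k = 0 then {id} else {})" by auto
  then show ?case by (cases k) auto
next
  case (insert a S)
  let ?g = "\<lambda>(b, p). transpose a b \<circ> p"
  let ?P = "\<lambda>k. {p. p permutes S \<and> card (orbit p ` S) = k}"
  \<comment> \<open>The case \<open>k = 0\<close> is separated because \<open>k - 1\<close> would be
    truncated to \<open>0\<close> there.\<close>
  let ?B = "{a} \<times> (if k = 0 then {} else ?P (k - 1)) \<union> S \<times> ?P k"
  have cnt: "card (orbit (transpose a b \<circ> p) ` insert a S) = k \<longleftrightarrow>
     (if a = b then k \<noteq> 0 \<and> card (orbit p ` S) = k - 1 else card (orbit p ` S) = k)"
    if "b \<in> insert a S" "p permutes S" for b p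
    using orbits_insert_transpose[OF insert.hyps that] by auto
  have "{p. p permutes insert a S \<and> card (orbit p ` insert a S) = k} =
    ?g ` {bp \<in> insert a S \<times> {p. p permutes S}. card (orbit (?g bp) ` insert a S) = k}"
  proof -
    have "{p. p permutes insert a S \<and> card (orbit p ` insert a S) = k} =
      {p \<in> {p. p permutes insert a S}. card (orbit p ` insert a S) = k}" by simp
    also have "\<dots> = {p \<in> ?g ` (insert a S \<times> {p. p permutes S}). card (orbit p ` insert a S) = k}"
      by (simp only: permutes_insert_image)
    also have "\<dots> = ?g ` {bp \<in> insert a S \<times> {p. p permutes S}. card (orbit (?g bp) ` insert a S) = k}"
      by (rule Compr_image_eq)
    finally show ?thesis .
  qed
  also have "{bp \<in> insert a S \<times> {p. p permutes S}. card (orbit (?g bp) ` insert a S) = k} = ?B"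
  proof (rule set_eqI)
    fix x :: "'a \<times> ('a \<Rightarrow> 'a)"
    obtain b p where x: "x = (b, p)" by fastforce
    show "x \<in> {bp \<in> insert a S \<times> {p. p permutes S}. card (orbit (?g bp) ` insert a S) = k} \<longleftrightarrow> x \<in> ?B"
    proof (cases "b \<in> insert a S \<and> p permutes S")
      case True
      then show ?thesis using cnt[of b p] insert.hyps(2) unfolding x
        by (auto simp del: image_insert split: if_splits)
    qed (auto simp: x split: if_splits)
  qed
  finally have "card {p. p permutes insert a S \<and> card (orbit p ` insert a S) = k} = card (?g ` ?B)"
    by (rule arg_cong)
  also have "\<dots> = card ?B"
    by (rule card_image, rule inj_on_subset[OF inj_on_transpose_comp[OF insert.hyps(2)]])
      (auto split: if_splits)
  also have "\<dots> = card ({a} \<times> (if k = 0 then {} else ?P (k - 1))) + card (S \<times> ?P k)"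
    using insert.hyps finite_permutations[of S]
    by (intro card_Un_disjoint) auto
  also have "\<dots> = stirling (card (insert a S)) k"
    using insert by (cases k; cases "card S") (auto simp: card_cartesian_product)
  finally show ?case .
qed

text \<open>Inserting \<open>a\<close> into an existing cycle flips the sign and adds a point but no
  cycle; adding \<open>a\<close> as a 1-cycle keeps the sign and adds one of each.\<close>

lemma evenperm_iff_orbits:
  assumes "finite S" "p permutes S"
  shows "evenperm p \<longleftrightarrow> even (card S + card (orbit p ` S))"
  using assms
proof (induction arbitrary: p rule: finite_induct)
  case empty
  then show ?case by simp
next
  case (insert a S)
  have "p \<in> (\<lambda>(b, p). transpose a b \<circ> p) ` (insert a S \<times> {p. p permutes S})"
    using insert.prems by (simp only: permutes_insert_image[symmetric] mem_Collect_eq)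
  then obtain b q where p: "p = transpose a b \<circ> q" "b \<in> insert a S" "q permutes S"
    by (elim imageE SigmaE) simp
  have "evenperm p \<longleftrightarrow> (a = b \<longleftrightarrow> evenperm q)"
    unfolding p(1) using p(3) insert.hyps permutation_permutes
    by (subst evenperm_comp) (auto simp: permutation_swap_id evenperm_swap)
  then show ?case
    using insert.IH[OF p(3)] insert.hyps orbits_insert_transpose[OF insert.hyps p(2,3)] p(1)
    by (simp del: image_insert o_apply)
qed

section \<open>The factorisation through the first-return map\<close>

text \<open>Translates the separation condition of \<open>DD_sub\<close> into first returns. The
  return of \<open>x\<close> is a point of \<open>R\<close> in the cycle of \<open>x\<close>, hence
  \<open>x\<close> itself if that cycle has no other point of \<open>R\<close>.\<close>

lemma distinct_orbits_iff_first_return: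
  assumes perm: "permutation \<sigma>"
  shows "(\<forall>x\<in>R. \<forall>y\<in>R. x \<noteq> y \<longrightarrow> orbit \<sigma> x \<noteq> orbit \<sigma> y) \<longleftrightarrow>
    (\<forall>x\<in>R. first_return \<sigma> R x x)" (is "?L \<longleftrightarrow> ?R")
proof
  assume ?L
  show ?R
  proof
    fix x assume x: "x \<in> R"
    obtain y where y: "first_return \<sigma> R x y"
      using first_return_exists[OF permutation_self_in_orbit[OF perm] x] by blast
    have "orbit \<sigma> y = orbit \<sigma> x"
      by (rule orbit_cyclic_eq3[OF cyclic_on_orbit'[OF perm] first_return_in_orbit[OF y]])
    then have "x = y" using \<open>?L\<close> x first_return_in[OF y] by blast
    with y show "first_return \<sigma> R x x" by blast
  qed
next
  assume ?R
  then have "orbit \<sigma> x \<inter> R = {x}" if "x \<in> R" for x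
  proof -
    \<comment> \<open>Here \<open>id\<close> serves as the first-return map on \<open>R\<close>, so
      the trace of the cycle is an orbit of \<open>id\<close>.\<close>
    have "orbit \<sigma> x \<inter> R = orbit id x"
      by (rule orbit_Int_first_return[OF that]) (use \<open>?R\<close> in simp)
    then show ?thesis using orbit_eq_singleton_iff[of id x] by simp
  qed
  then show ?L by blast
qed

text \<open>As \<open>\<rho>\<close> returns each point of \<open>R = {1..r}\<close> to itself, it
  can send such a point into \<open>R\<close> only by fixing it. So \<open>p\<close> maps the points
  counted by \<open>u\<close> in \<open>DD\<close> bijectively onto the fixed points of
  \<open>\<rho>\<close> in \<open>R\<close>, while beyond \<open>R\<close> the permutation
  \<open>p\<close> does nothing.\<close>

lemma comp_in_DD_iff:
  assumes "p permutes {1..r}"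
    and \<rho>: "\<rho> permutes {1..r+n}" "\<And>x. x \<in> {1..r} \<Longrightarrow> first_return \<rho> {1..r} x x"
  shows "\<rho> \<circ> p \<in> DD r u m n \<longleftrightarrow> \<rho> \<in> DD_sub r u m n"
proof -
  have "p permutes {1..r+n}" using assms(1) by (rule permutes_subset) auto
  then have perm: "\<rho> \<circ> p permutes {1..r+n}" using \<rho>(1) by (rule permutes_compose)
  have fixed: "\<rho> x \<in> {1..r} \<longleftrightarrow> \<rho> x = x" if "x \<in> {1..r}" for x
    using \<rho>(2)[OF that] that first_return.enter first_return_unique by metis
  have "p ` {x \<in> {1..r}. (\<rho> \<circ> p) x \<in> {1..r}} = {x \<in> {1..r}. \<rho> x \<in> {1..r}}"
  proof -
    have "p ` {x \<in> {1..r}. (\<rho> \<circ> p) x \<in> {1..r}} = {x \<in> p ` {1..r}. \<rho> x \<in> {1..r}}" by auto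
    then show ?thesis using permutes_image[OF assms(1)] by simp
  qed
  also have "\<dots> = {x \<in> {1..r}. \<rho> x = x}" using fixed by blast
  finally have "card {x \<in> {1..r}. \<rho> x = x} = card (p ` {x \<in> {1..r}. (\<rho> \<circ> p) x \<in> {1..r}})"
    by (rule arg_cong[OF sym])
  also have "\<dots> = card {x \<in> {1..r}. (\<rho> \<circ> p) x \<in> {1..r}}"
    by (rule card_image[OF permutes_inj_on[OF assms(1)]])
  finally have "card {x \<in> {1..r}. (\<rho> \<circ> p) x \<in> {1..r}} = card {x \<in> {1..r}. \<rho> x = x}" ..
  moreover have "{t \<in> {r+1..r+n}. (\<rho> \<circ> p) t = t} = {t \<in> {r+1..r+n}. \<rho> t = t}"
    using permutes_not_in[OF assms(1)] by auto
  ultimately show ?thesis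
    using perm distinct_orbits_iff_first_return[OF permutes_imp_permutation[OF finite_atLeastAtMost \<rho>(1)]] \<rho>
    unfolding DD_def DD_sub_def by auto
qed

lemma bij_betw_DD:
  "bij_betw (\<lambda>(\<rho>, p). \<rho> \<circ> p) (DD_sub r u m n \<times> {p. p permutes {1..r}}) (DD r u m n)"
proof -
  have sub: "\<rho> permutes {1..r+n}" "\<forall>x\<in>{1..r}. first_return \<rho> {1..r} x x"
    if "\<rho> \<in> DD_sub r u m n" for \<rho>
  proof -
    show "\<rho> permutes {1..r+n}" using that by (simp add: DD_sub_def)
    from distinct_orbits_iff_first_return[OF permutes_imp_permutation[OF finite_atLeastAtMost this]] that
    show "\<forall>x\<in>{1..r}. first_return \<rho> {1..r} x x" by (simp add: DD_sub_def)
  qed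
  show ?thesis unfolding bij_betw_def
  proof
    show "inj_on (\<lambda>(\<rho>, p). \<rho> \<circ> p) (DD_sub r u m n \<times> {p. p permutes {1..r}})"
    proof (rule inj_onI, clarsimp)
      fix \<rho> p \<rho>' p'
      assume a: "\<rho> \<in> DD_sub r u m n" "\<rho>' \<in> DD_sub r u m n" "p permutes {Suc 0..r}"
        "p' permutes {Suc 0..r}" and eq: "\<rho> \<circ> p = \<rho>' \<circ> p'"
      \<comment> \<open>On \<open>{1..r}\<close> both factors are the first-return map of the common
        product, so they are determined by it.\<close>
      have "p x = p' x" for x
      proof (cases "x \<in> {1..r}")
        case True
        then have "p x \<in> {1..r}" "p' x \<in> {1..r}" using a permutes_in_image by (metis One_nat_def)+
        then have "first_return (\<rho> \<circ> p) {1..r} x (p x)" "first_return (\<rho>' \<circ> p') {1..r} x (p' x)"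
          using a sub by (auto intro!: first_return_comp)
        then show ?thesis using eq first_return_unique by metis
      next
        case False
        then show ?thesis using a by (simp add: permutes_not_in)
      qed
      then have "p = p'" by blast
      with eq a show "\<rho> = \<rho>' \<and> p = p'"
        by (metis comp_assoc comp_id permutes_inv_o(1))
    qed
    show "(\<lambda>(\<rho>, p). \<rho> \<circ> p) ` (DD_sub r u m n \<times> {p. p permutes {1..r}}) = DD r u m n"
    proof (intro equalityI subsetI)
      fix \<sigma> assume "\<sigma> \<in> (\<lambda>(\<rho>, p). \<rho> \<circ> p) ` (DD_sub r u m n \<times> {p. p permutes {1..r}})"
      then show "\<sigma> \<in> DD r u m n" using comp_in_DD_iff sub by auto
    next
      fix \<sigma> assume \<sigma>: "\<sigma> \<in> DD r u m n"
      then have perm: "\<sigma> permutes {1..r+n}" by (simp add: DD_def)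
      obtain p where p: "p permutes {1..r}" "\<And>x. x \<in> {1..r} \<Longrightarrow> first_return \<sigma> {1..r} x (p x)"
        using return_map_exists[OF perm, of "{1..r}"] by auto
      define \<rho> where "\<rho> = \<sigma> \<circ> inv p"
      have inv: "inv p permutes {1..r}" using p(1) by (rule permutes_inv)
      then have "inv p permutes {1..r+n}" by (rule permutes_subset) auto
      then have \<rho>: "\<rho> permutes {1..r+n}" unfolding \<rho>_def using perm by (rule permutes_compose)
      \<comment> \<open>Under \<open>\<sigma>\<close> the point \<open>inv p x\<close> returns to
        \<open>p (inv p x) = x\<close>; precomposing with \<open>inv p\<close> moves the start of
        this path to \<open>x\<close>.\<close>
      have "first_return \<rho> {1..r} x x" if x: "x \<in> {1..r}" for x
      proof -
        have "inv p x \<in> {1..r}" using x permutes_in_image[OF inv] by blast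
        then have "first_return \<sigma> {1..r} (inv p x) x"
          using p(2) permutes_inverses(1)[OF p(1)] by metis
        then show ?thesis unfolding \<rho>_def by (rule first_return_comp[OF inv])
      qed
      moreover have "\<sigma> = \<rho> \<circ> p"
        unfolding \<rho>_def using permutes_inv_o(2)[OF p(1)] by (simp add: comp_assoc)
      ultimately have "\<rho> \<in> DD_sub r u m n" using comp_in_DD_iff p(1) \<rho> \<sigma> by blast
      with p(1) \<open>\<sigma> = \<rho> \<circ> p\<close> show "\<sigma> \<in> (\<lambda>(\<rho>, p). \<rho> \<circ> p) ` (DD_sub r u m n \<times> {p. p permutes {1..r}})"
        by force
    qed
  qed
qed

section \<open>Counting through the factorisation\<close>

text \<open>A property that splits into independent conditions on the two factors is counted by a
  product, because the bijection restricts to a product set.\<close>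

lemma card_DD_filter:
  assumes "\<And>\<rho> p. \<rho> \<in> DD_sub r u m n \<Longrightarrow> p permutes {1..r} \<Longrightarrow> P (\<rho> \<circ> p) \<longleftrightarrow> Q \<rho> \<and> S p"
  shows "card {\<sigma> \<in> DD r u m n. P \<sigma>} =
    card {\<rho> \<in> DD_sub r u m n. Q \<rho>} * card {p. p permutes {1..r} \<and> S p}"
proof -
  let ?g = "\<lambda>(\<rho>, p). \<rho> \<circ> p"
  let ?X = "{\<rho> \<in> DD_sub r u m n. Q \<rho>} \<times> {p. p permutes {1..r} \<and> S p}"
  have "{\<sigma> \<in> DD r u m n. P \<sigma>} = ?g ` ?X"
    using bij_betw_imp_surj_on[OF bij_betw_DD[of r u m n], symmetric] assms by auto
  moreover have "inj_on ?g ?X"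
    by (rule inj_on_subset[OF bij_betw_imp_inj_on[OF bij_betw_DD[of r u m n]]]) auto
  ultimately show ?thesis by (simp add: card_image card_cartesian_product)
qed

text \<open>Each cycle meeting \<open>{1..r}\<close> is the orbit of one of its points there, and
  \<open>p\<close> is the first-return map of \<open>\<rho> \<circ> p\<close>, so the two orbit
  counts agree.\<close>

lemma cycles_meeting_comp:
  assumes "\<rho> \<in> DD_sub r u m n" "p permutes {1..r}"
  shows "card {C \<in> cycles (r+n) (\<rho> \<circ> p). C \<inter> {1..r} \<noteq> {}} = card (orbit p ` {1..r})"
proof -
  let ?\<sigma> = "\<rho> \<circ> p"
  have \<rho>: "\<rho> permutes {1..r+n}" using assms by (simp add: DD_sub_def)
  have "p permutes {1..r+n}" using assms(2) by (rule permutes_subset) auto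
  then have \<sigma>: "?\<sigma> permutes {1..r+n}" using \<rho> by (rule permutes_compose)
  then have perm: "permutation ?\<sigma>" by (rule permutes_imp_permutation[OF finite_atLeastAtMost])
  have "{C \<in> cycles (r+n) ?\<sigma>. C \<inter> {1..r} \<noteq> {}} = orbit ?\<sigma> ` {1..r}"
  proof (intro equalityI subsetI)
    fix C assume "C \<in> {C \<in> cycles (r+n) ?\<sigma>. C \<inter> {1..r} \<noteq> {}}"
    then obtain x y where "C = orbit ?\<sigma> x" "y \<in> C" "y \<in> {1..r}" unfolding cycles_def by blast
    then show "C \<in> orbit ?\<sigma> ` {1..r}"
      using cyclic_on_orbit'[OF perm] by (metis image_eqI orbit_cyclic_eq3)
  next
    fix C assume "C \<in> orbit ?\<sigma> ` {1..r}"
    then obtain x where "C = orbit ?\<sigma> x" "x \<in> {1..r}" by blast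
    then show "C \<in> {C \<in> cycles (r+n) ?\<sigma>. C \<inter> {1..r} \<noteq> {}}"
      using permutation_self_in_orbit[OF perm, of x] by (auto simp: cycles_def)
  qed
  moreover have "first_return ?\<sigma> {1..r} x (p x)" if "x \<in> {1..r}" for x
  proof (rule first_return_comp[OF assms(2)])
    have "p x \<in> {1..r}" using that permutes_in_image[OF assms(2)] by blast
    then show "first_return \<rho> {1..r} (p x) (p x)"
      using distinct_orbits_iff_first_return[OF permutes_imp_permutation[OF finite_atLeastAtMost \<rho>]] assms(1)
      by (simp add: DD_sub_def)
  qed
  ultimately show ?thesis using card_orbits_first_return[OF perm] by metis
qed

lemma evenperm_DD_comp:
  assumes "\<rho> \<in> DD_sub r u m n" "p permutes {1..r}"
  shows "evenperm (\<rho> \<circ> p) \<longleftrightarrow> (evenperm \<rho> \<longleftrightarrow> even (r + card (orbit p ` {1..r})))"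
proof -
  have "permutation \<rho>" "permutation p"
    using assms by (auto simp: DD_sub_def intro: permutes_imp_permutation[OF finite_atLeastAtMost])
  then show ?thesis using evenperm_iff_orbits[OF _ assms(2)] by (simp add: evenperm_comp)
qed

text \<open>The transposition is absorbed into the factor \<open>p\<close>, which ranges over all
  permutations of \<open>{1..r}\<close>; \<open>r \<ge> 2\<close> puts both \<open>1\<close> and
  \<open>2\<close> in that set.\<close>

lemma comp_transpose_in_DD:
  assumes "r \<ge> 2" "\<sigma> \<in> DD r u m n"
  shows "\<sigma> \<circ> transpose 1 2 \<in> DD r u m n"
proof -
  note DD_image = bij_betw_imp_surj_on[OF bij_betw_DD[of r u m n], symmetric]
  obtain \<rho> p where \<rho>: "\<sigma> = \<rho> \<circ> p" "\<rho> \<in> DD_sub r u m n" "p permutes {1..r}"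
    using assms(2) unfolding DD_image by (elim imageE SigmaE) simp
  have "p \<circ> transpose 1 2 permutes {1..r}"
    using \<rho>(3) assms(1) by (intro permutes_compose permutes_swap_id) auto
  then show ?thesis
    unfolding DD_image \<rho>(1) using \<rho>(2)
    by (intro image_eqI[where x = "(\<rho>, p \<circ> transpose 1 2)"]) (simp_all add: comp_assoc)
qed

text \<open>Precomposition with the transposition of \<open>1\<close> and \<open>2\<close> is a
  parity-reversing involution of \<open>DD\<close>, so the even and odd elements are equally
  many.\<close>

lemma two_D_par:
  assumes "r \<ge> 2" "i \<in> {0, 1}"
  shows "2 * D_par i r u m n = D r u m n"
proof -
  let ?E = "\<lambda>i. {\<sigma> \<in> DD r u m n. par \<sigma> = i}"
  let ?t = "\<lambda>\<sigma>. \<sigma> \<circ> transpose 1 (2::nat)"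
  have par: "par (?t \<sigma>) = 1 - par \<sigma>" if "\<sigma> \<in> DD r u m n" for \<sigma>
  proof -
    have "permutation \<sigma>" 
      using that by (auto simp: DD_def intro: permutes_imp_permutation[OF finite_atLeastAtMost])
    then show ?thesis by (simp add: par_def evenperm_comp permutation_swap_id evenperm_swap)
  qed
  have "bij_betw ?t (?E 0) (?E 1)"
    by (rule bij_betwI[where g = ?t])
      (use par comp_transpose_in_DD[OF assms(1)] in \<open>auto simp: comp_assoc\<close>)
  then have "card (?E 0) = card (?E 1)" by (rule bij_betw_same_card)
  moreover have "finite (DD r u m n)"
    by (rule finite_subset[OF _ finite_permutations[of "{1..r+n}"]]) (auto simp: DD_def)
  then have "card (?E 0 \<union> ?E 1) = card (?E 0) + card (?E 1)"
    by (intro card_Un_disjoint) auto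
  moreover have "?E 0 \<union> ?E 1 = DD r u m n" by (auto simp: par_def)
  ultimately show ?thesis using assms(2) unfolding D_par_def D_def by auto
qed

theorem theorem4p1:
  fixes r u m n k i :: nat
  assumes "i \<in> {0, 1}"
  shows "D_k k r u m n = stirling r k * D_sub r u m n
    \<and> D r u m n = fact r * D_sub r u m n
    \<and> (r \<ge> 2 \<longrightarrow> real (D_par i r u m n) = fact r / 2 * real (D_sub r u m n))
    \<and> (r \<in> {0, 1} \<longrightarrow> D_par i r u m n = D_sub_par i r u m n)
    \<and> D_k_par k i r u m n = stirling r k * D_sub_par ((r + k + i) mod 2) r u m n"
proof (intro conjI impI)
  have stir: "card {p. p permutes {1..r} \<and> card (orbit p ` {1..r}) = k} = stirling r k"
    using card_permutes_orbits[of "{1..r}"] by simp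
  have "D_k k r u m n = card {\<rho> \<in> DD_sub r u m n. True} *
      card {p. p permutes {1..r} \<and> card (orbit p ` {1..r}) = k}"
    unfolding D_k_def by (rule card_DD_filter) (simp add: cycles_meeting_comp del: One_nat_def)
  then show "D_k k r u m n = stirling r k * D_sub r u m n"
    using stir by (simp add: D_sub_def)
  have "D r u m n = card {\<sigma> \<in> DD r u m n. True}" by (simp add: D_def)
  also have "\<dots> = card {\<rho> \<in> DD_sub r u m n. True} * card {p. p permutes {1..r} \<and> True}"
    by (rule card_DD_filter) simp
  finally show total: "D r u m n = fact r * D_sub r u m n"
    using card_permutations[of "{1..r}" r] by (simp add: D_sub_def)
  show "real (D_par i r u m n) = fact r / 2 * real (D_sub r u m n)" if "r \<ge> 2"
  proof -
    have "real (2 * D_par i r u m n) = real (fact r * D_sub r u m n)"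
      using two_D_par[OF that assms] total by simp
    then show ?thesis by simp
  qed
  show "D_par i r u m n = D_sub_par i r u m n" if "r \<in> {0, 1}"
  proof -
    \<comment> \<open>With at most one point in \<open>{1..r}\<close> the factor \<open>p\<close> is
      trivial, so the bijection identifies the two sets themselves.\<close>
    have "{p. p permutes {1..r}} = {id}" using that by auto
    then have "DD r u m n = DD_sub r u m n"
      using bij_betw_imp_surj_on[OF bij_betw_DD[of r u m n]] by force
    then show ?thesis by (simp add: D_par_def D_sub_par_def)
  qed
  have "D_k_par k i r u m n = card {\<rho> \<in> DD_sub r u m n. par \<rho> = (r + k + i) mod 2} *
      card {p. p permutes {1..r} \<and> card (orbit p ` {1..r}) = k}"
    unfolding D_k_par_def
  proof (rule card_DD_filter)
    fix \<rho> p assume a: "\<rho> \<in> DD_sub r u m n" "p permutes {1..r}"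
    \<comment> \<open>Once \<open>p\<close> has \<open>k\<close> cycles its sign is fixed by the
      parity of \<open>r + k\<close>, so the parity of the product becomes a condition on
      \<open>\<rho>\<close> alone; this makes the joint property split.\<close>
    have "par (\<rho> \<circ> p) = i \<longleftrightarrow> par \<rho> = (r + k + i) mod 2" if "card (orbit p ` {1..r}) = k"
    proof -
      have "evenperm (\<rho> \<circ> p) \<longleftrightarrow> (evenperm \<rho> \<longleftrightarrow> even (r + k))"
        using evenperm_DD_comp[OF a] that by simp
      moreover have "(r + k + i) mod 2 = (if even (r + k) then i else 1 - i)"
        using assms by (cases "even (r + k)") (auto simp: mod2_eq_if)
      ultimately show ?thesis using assms by (simp only: par_def) auto
    qed
    then show "card {C \<in> cycles (r + n) (\<rho> \<circ> p). C \<inter> {1..r} \<noteq> {}} = k \<and> par (\<rho> \<circ> p) = i \<longleftrightarrow>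
        par \<rho> = (r + k + i) mod 2 \<and> card (orbit p ` {1..r}) = k"
      unfolding cycles_meeting_comp[OF a] by blast
  qed
  then show "D_k_par k i r u m n = stirling r k * D_sub_par ((r + k + i) mod 2) r u m n"
    using stir by (simp add: D_sub_par_def)
qed

end
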